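(* Let $f:(a,b)\to\mathbb{R}$ be a $\Phi$-convex function with $\Phi:[0,b-a]\to[0,\infty)$, and let $\varphi:(a,b)\to\mathbb{R}$ be a function such that $f(u)+(x-u)\varphi(u)\le f(x)+\Phi(|u-x|)$ for all $x,u\in(a,b)$. Let $x_1,\dots,x_n\in(a,b)$, let $(a_1,\dots,a_n)$ be a nonnegative $n$-tuple with $A_n=\sum_{i=1}^n a_i>0$, and let $\overline{x}=\frac{1}{A_n}\sum_{i=1}^n a_ix_i$. Then $$0\le\left|\frac{1}{A_n}\sum_{i=1}^n a_i\left|f(x_i)-f(\overline{x})+\Phi(|\overline{x}-x_i|)\right|-\frac{1}{A_n}\sum_{i=1}^n a_i|\varphi(\overline{x})|\,|\overline{x}-x_i|\right|$$ $$\le\frac{1}{A_n}\sum_{i=1}^n a_if(x_i)-f(\overline{x})+\frac{1}{A_n}\sum_{i=1}^n a_i\Phi(|\overline{x}-x_i|).$$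
   Context: A real function $f$ on an interval with endpoints $a<b$ is $\Phi$-convex, with error function $\Phi:[0,b-a]\to[0,\infty)$, if $tf(x)+(1-t)f(y)+t\Phi((1-t)|x-y|)+(1-t)\Phi(t|x-y|)\ge f(tx+(1-t)y)$ for all $x,y$ in the interval and all $t\in[0,1]$. It is known that for such $f$ a function $\varphi$ with $f(u)+(x-u)\varphi(u)\le f(x)+\Phi(|u-x|)$ for all $x,u$ exists. *)

theory Defs
  imports Complex_Main "HOL-Library.FuncSet"
begin

text \<open>
  The error function is a total function on the reals. When \<open>I\<close> has endpoints
  \<open>a < b\<close>, only its values on \<open>{0..b - a}\<close> enter here. Its nonnegativity there is
  not part of this predicate and has to be assumed separately.
\<close>

definition Phi_convex_on :: "real set \<Rightarrow> (real \<Rightarrow> real) \<Rightarrow> (real \<Rightarrow> real) \<Rightarrow> bool" where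
  "Phi_convex_on I \<Phi> f \<longleftrightarrow>
     (\<forall>x\<in>I. \<forall>y\<in>I. \<forall>t\<in>{0..1}.
        t * f x + (1 - t) * f y + t * \<Phi> ((1 - t) * \<bar>x - y\<bar>) + (1 - t) * \<Phi> (t * \<bar>x - y\<bar>)
          \<ge> f (t * x + (1 - t) * y))"

end

theory Submission
  imports Defs "HOL-Analysis.Convex"
begin

text \<open>
  Put \<open>p i = f (x i) - f xbar + \<Phi> \<bar>xbar - x i\<bar>\<close> and \<open>q i = (x i - xbar) * \<phi> xbar\<close>. The hypothesis on \<open>\<phi>\<close>,
  used at \<open>u = xbar\<close>, says \<open>q i \<le> p i\<close>, so the reverse triangle inequality reads
  \<open>\<bar>\<bar>p i\<bar> - \<bar>q i\<bar>\<bar> \<le> p i - q i\<close>. Averaging gives the claim, because the weighted mean of the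
  \<open>q i\<close> vanishes.
\<close>

text \<open>Moving the absolute value inside the combined sum reduces the claim to single terms,
  where \<open>0 \<le> w i\<close> lets the weight be pulled out and preserves the bound.\<close>

lemma abs_weighted_sum_abs_diff_le:
  fixes w p q :: "'a \<Rightarrow> 'b :: linordered_idom"
  assumes "\<And>i. i \<in> S \<Longrightarrow> 0 \<le> w i" and "\<And>i. i \<in> S \<Longrightarrow> q i \<le> p i"
  shows "\<bar>(\<Sum>i\<in>S. w i * \<bar>p i\<bar>) - (\<Sum>i\<in>S. w i * \<bar>q i\<bar>)\<bar> \<le> (\<Sum>i\<in>S. w i * p i) - (\<Sum>i\<in>S. w i * q i)"
proof -
  have "\<bar>\<Sum>i\<in>S. w i * (\<bar>p i\<bar> - \<bar>q i\<bar>)\<bar> \<le> (\<Sum>i\<in>S. w i * (p i - q i))"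
  proof (rule order_trans[OF sum_abs], rule sum_mono)
    fix i assume "i \<in> S"
    then have "0 \<le> w i" and "q i \<le> p i" using assms by auto
    moreover from \<open>q i \<le> p i\<close> have "\<bar>\<bar>p i\<bar> - \<bar>q i\<bar>\<bar> \<le> p i - q i"
      using abs_triangle_ineq3[of "p i" "q i"] by simp
    ultimately show "\<bar>w i * (\<bar>p i\<bar> - \<bar>q i\<bar>)\<bar> \<le> w i * (p i - q i)"
      by (simp add: abs_mult mult_left_mono)
  qed
  then show ?thesis
    by (simp add: right_diff_distrib sum_subtractf)
qed

theorem theorem11:
  fixes a b :: real and f \<phi> \<Phi> :: "real \<Rightarrow> real"
    and n :: nat and x w :: "nat \<Rightarrow> real" and A xbar :: real
  assumes "a < b"
    and "\<Phi> \<in> {0..b - a} \<rightarrow> {0..}"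
    and "Phi_convex_on {a<..<b} \<Phi> f"
    and "\<And>x u. x \<in> {a<..<b} \<Longrightarrow> u \<in> {a<..<b} \<Longrightarrow> f u + (x - u) * \<phi> u \<le> f x + \<Phi> \<bar>u - x\<bar>"
    and "\<And>i. i \<in> {1..n} \<Longrightarrow> x i \<in> {a<..<b}"
    and "\<And>i. i \<in> {1..n} \<Longrightarrow> 0 \<le> w i"
    and "A = (\<Sum>i=1..n. w i)" and "A > 0"
    and "xbar = (1 / A) * (\<Sum>i=1..n. w i * x i)"
  shows "0 \<le> \<bar>(1 / A) * (\<Sum>i=1..n. w i * \<bar>f (x i) - f xbar + \<Phi> \<bar>xbar - x i\<bar>\<bar>)
              - (1 / A) * (\<Sum>i=1..n. w i * \<bar>\<phi> xbar\<bar> * \<bar>xbar - x i\<bar>)\<bar> \<and>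
         \<bar>(1 / A) * (\<Sum>i=1..n. w i * \<bar>f (x i) - f xbar + \<Phi> \<bar>xbar - x i\<bar>\<bar>)
              - (1 / A) * (\<Sum>i=1..n. w i * \<bar>\<phi> xbar\<bar> * \<bar>xbar - x i\<bar>)\<bar>
           \<le> (1 / A) * (\<Sum>i=1..n. w i * f (x i)) - f xbar
              + (1 / A) * (\<Sum>i=1..n. w i * \<Phi> \<bar>xbar - x i\<bar>)"
proof -
  let ?p = "\<lambda>i. f (x i) - f xbar + \<Phi> \<bar>xbar - x i\<bar>"
  let ?q = "\<lambda>i. (x i - xbar) * \<phi> xbar"
  have mean: "(\<Sum>i=1..n. w i * x i) = A * xbar"
    using assms(8,9) by simp
  \<comment> \<open>The hypothesis on \<open>\<phi>\<close> can be applied at \<open>xbar\<close>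
    only if \<open>xbar\<close> lies in the interval. It does, since the interval is convex and the
    normalized weights \<open>w i / A\<close> are nonnegative with sum 1.\<close>
  have "(\<Sum>i=1..n. (w i / A) *\<^sub>R x i) \<in> {a<..<b}"
    using assms(5-8)
    by (intro convex_sum) (auto simp: sum_divide_distrib[symmetric])
  also have "(\<Sum>i=1..n. (w i / A) *\<^sub>R x i) = xbar"
    by (simp add: assms(9) sum_divide_distrib)
  finally have "?q i \<le> ?p i" if "i \<in> {1..n}" for i
    using assms(4)[OF assms(5)[OF that]] by fastforce
  then have le: "\<bar>(\<Sum>i=1..n. w i * \<bar>?p i\<bar>) - (\<Sum>i=1..n. w i * \<bar>?q i\<bar>)\<bar>
      \<le> (\<Sum>i=1..n. w i * ?p i) - (\<Sum>i=1..n. w i * ?q i)"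
    using assms(6) by (intro abs_weighted_sum_abs_diff_le)
  \<comment> \<open>The slope \<open>\<phi> xbar\<close> is the same for all \<open>i\<close>, so it
    factors out and leaves the weighted deviations from the mean, which cancel by
    \<open>mean\<close>.\<close>
  have "(\<Sum>i=1..n. w i * ?q i) = ((\<Sum>i=1..n. w i * x i) - A * xbar) * \<phi> xbar"
    by (simp add: assms(7) sum_distrib_left sum_distrib_right sum_subtractf algebra_simps)
  then have q0: "(\<Sum>i=1..n. w i * ?q i) = 0"
    unfolding mean by simp
  have p: "(\<Sum>i=1..n. w i * ?p i)
      = (\<Sum>i=1..n. w i * f (x i)) - A * f xbar + (\<Sum>i=1..n. w i * \<Phi> \<bar>xbar - x i\<bar>)"
    by (simp add: assms(7) sum_distrib_left sum_subtractf sum.distrib algebra_simps)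
  have q: "(\<Sum>i=1..n. w i * \<bar>?q i\<bar>) = (\<Sum>i=1..n. w i * \<bar>\<phi> xbar\<bar> * \<bar>xbar - x i\<bar>)"
    by (simp add: abs_mult abs_minus_commute mult_ac)
  \<comment> \<open>As \<open>A > 0\<close>, the common factor \<open>1 / A\<close> leaves the
    absolute value unchanged, so the unnormalized bound \<open>le\<close> can simply be divided by
    \<open>A\<close>.\<close>
  have "\<bar>(1 / A) * (\<Sum>i=1..n. w i * \<bar>?p i\<bar>)
        - (1 / A) * (\<Sum>i=1..n. w i * \<bar>\<phi> xbar\<bar> * \<bar>xbar - x i\<bar>)\<bar>
      = \<bar>(\<Sum>i=1..n. w i * \<bar>?p i\<bar>) - (\<Sum>i=1..n. w i * \<bar>\<phi> xbar\<bar> * \<bar>xbar - x i\<bar>)\<bar> / A"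
    using \<open>A > 0\<close> by (simp add: diff_divide_distrib[symmetric])
  also have "\<dots> \<le> ((\<Sum>i=1..n. w i * f (x i)) - A * f xbar
      + (\<Sum>i=1..n. w i * \<Phi> \<bar>xbar - x i\<bar>)) / A"
    using le \<open>A > 0\<close> unfolding q0 p q by (simp add: divide_right_mono)
  also have "\<dots> = (1 / A) * (\<Sum>i=1..n. w i * f (x i)) - f xbar
      + (1 / A) * (\<Sum>i=1..n. w i * \<Phi> \<bar>xbar - x i\<bar>)"
    using \<open>A > 0\<close> by (simp add: add_divide_distrib diff_divide_distrib)
  finally show ?thesis by simp
qed

end
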